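(* For every positive integer $n$ with $8\le\frac{1}{648}\log\log n$, let $G_{n,8}$ be an $n$-vertex graph satisfying: (i) $G_{n,8}$ has average degree at least $8$ and maximum degree at most $48$; (ii) $G_{n,8}$ has girth at least $\log n/48^2$; (iii) every $t$-vertex subgraph $H$ of $G_{n,8}$ with $t\ge \log n/48^2$ satisfies $\mathrm{sep}_V(H) \le \mathrm{sep}_E(H)\le \frac{t}{\log t}(\log\log t)^2$. Then $G_{n,8}$ is not $(\frac12, n^{1/4608})$-hyperfinite. In particular, setting $$\mathcal{F}_8=\{G \,:\, G \text{ is an induced subgraph of } G_{n,8} \text{ for some } n\}$$ we get a hereditary family of graphs that is not hyperfinite, despite the fact that for every $m\ge 2$ every $m$-vertex graph $G \in \mathcal{F}_8$ satisfies $\mathrm{sep}_E(G) \le \frac{m}{\log m}(\log\log m)^2+48$.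
   Context: Graphs are finite, simple and undirected; subgraphs are not necessarily induced unless stated; $\log$ denotes $\log_2$. The girth of a graph is the minimum length of a cycle in it. A family of graphs is hereditary if it is closed under taking induced subgraphs. An edge separator in a graph $G=(V,E)$ is a set $F\subseteq E$ for which there is a partition $V=A\cup B$ with $|A|,|B|\le\frac23|V|$ and no edge of $E\setminus F$ between $A$ and $B$; $\mathrm{sep}_E(G)$ is the minimum cardinality of an edge separator. A vertex separator is a set $S\subseteq V$ such that $V\setminus S$ can be partitioned into two sets $A,B$ with $|A|,|B|\le\frac23|V|$ and no edge of $G$ between $A$ and $B$; $\mathrm{sep}_V(G)$ is the minimum cardinality of a vertex separator. A graph is $(\epsilon,q)$-hyperfinite if one can remove at most an $\epsilon$-fraction of its edges and thus decompose it into connected components of size (number of vertices) at most $q$ each. A family of graphs is hyperfinite if there is a function $q$ such that for every $\epsilon>0$, every graph in the family is $(\epsilon,q(\epsilon))$-hyperfinite. For every $n$ with $8\le\frac{1}{648}\log\log n$, an $n$-vertex graph satisfying (i)-(iii) is known to exist, so graphs $G_{n,8}$ as in the claim can be chosen. *)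

theory Defs
  imports Complex_Main "HOL-Library.Extended_Real"
begin

datatype 'a graph = Graph (verts: "'a set") (edges: "'a set set")

definition simple_graph :: "'a graph \<Rightarrow> bool" where
  "simple_graph G \<longleftrightarrow> finite (verts G) \<and> edges G \<subseteq> {e. e \<subseteq> verts G \<and> card e = 2}"

definition subgraph :: "'a graph \<Rightarrow> 'a graph \<Rightarrow> bool" where
  "subgraph H G \<longleftrightarrow> simple_graph H \<and> verts H \<subseteq> verts G \<and> edges H \<subseteq> edges G"

definition induced_subgraph :: "'a graph \<Rightarrow> 'a graph \<Rightarrow> bool" where
  "induced_subgraph H G \<longleftrightarrow> verts H \<subseteq> verts G \<and> edges H = {e \<in> edges G. e \<subseteq> verts H}"

definition hereditary :: "'a graph set \<Rightarrow> bool" where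
  "hereditary \<F> \<longleftrightarrow> (\<forall>G\<in>\<F>. \<forall>H. induced_subgraph H G \<longrightarrow> H \<in> \<F>)"

definition degree :: "'a graph \<Rightarrow> 'a \<Rightarrow> nat" where
  "degree G v = card {e \<in> edges G. v \<in> e}"

definition average_degree :: "'a graph \<Rightarrow> real" where
  "average_degree G = (\<Sum>v\<in>verts G. real (degree G v)) / real (card (verts G))"

definition max_degree :: "'a graph \<Rightarrow> nat" where
  "max_degree G = Max (degree G ` verts G)"

(* The list enumerates the vertices of the cycle in cyclic order, without repeating the first one. *)
definition is_cycle :: "'a graph \<Rightarrow> 'a list \<Rightarrow> bool" where
  "is_cycle G vs \<longleftrightarrow> 3 \<le> length vs \<and> distinct vs \<and> set vs \<subseteq> verts G \<and>
     (\<forall>i < length vs. {vs ! i, vs ! (Suc i mod length vs)} \<in> edges G)"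

(* Acyclic graphs have girth infinity, being the infimum of the empty set in enat. *)
definition girth :: "'a graph \<Rightarrow> enat" where
  "girth G = Inf {enat (length vs) | vs. is_cycle G vs}"

definition edge_separator :: "'a graph \<Rightarrow> 'a set set \<Rightarrow> bool" where
  "edge_separator G F \<longleftrightarrow> F \<subseteq> edges G \<and>
     (\<exists>A B. A \<union> B = verts G \<and> A \<inter> B = {} \<and>
        real (card A) \<le> 2/3 * real (card (verts G)) \<and>
        real (card B) \<le> 2/3 * real (card (verts G)) \<and>
        (\<forall>a\<in>A. \<forall>b\<in>B. {a, b} \<notin> edges G - F))"

definition vertex_separator :: "'a graph \<Rightarrow> 'a set \<Rightarrow> bool" where
  "vertex_separator G S \<longleftrightarrow> S \<subseteq> verts G \<and>
     (\<exists>A B. A \<union> B = verts G - S \<and> A \<inter> B = {} \<and>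
        real (card A) \<le> 2/3 * real (card (verts G)) \<and>
        real (card B) \<le> 2/3 * real (card (verts G)) \<and>
        (\<forall>a\<in>A. \<forall>b\<in>B. {a, b} \<notin> edges G))"

(* A one-vertex graph has no edge separator; its sep_E is infinity. *)
definition sep_E :: "'a graph \<Rightarrow> enat" where
  "sep_E G = Inf {enat (card F) | F. edge_separator G F}"

definition sep_V :: "'a graph \<Rightarrow> enat" where
  "sep_V G = Inf {enat (card S) | S. vertex_separator G S}"

definition component_of :: "'a graph \<Rightarrow> 'a \<Rightarrow> 'a set" where
  "component_of G v = {u \<in> verts G. (v, u) \<in> {(x, y). {x, y} \<in> edges G}\<^sup>*}"

definition components :: "'a graph \<Rightarrow> 'a set set" where
  "components G = component_of G ` verts G"

definition delete_edges :: "'a graph \<Rightarrow> 'a set set \<Rightarrow> 'a graph" where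
  "delete_edges G F = Graph (verts G) (edges G - F)"

definition hyperfinite :: "real \<Rightarrow> real \<Rightarrow> 'a graph \<Rightarrow> bool" where
  "hyperfinite \<epsilon> q G \<longleftrightarrow> (\<exists>F \<subseteq> edges G. real (card F) \<le> \<epsilon> * real (card (edges G)) \<and>
     (\<forall>C \<in> components (delete_edges G F). real (card C) \<le> q))"

definition hyperfinite_family :: "'a graph set \<Rightarrow> bool" where
  "hyperfinite_family \<F> \<longleftrightarrow> (\<exists>q :: real \<Rightarrow> real. \<forall>\<epsilon>>0. \<forall>G\<in>\<F>. hyperfinite \<epsilon> (q \<epsilon>) G)"

(* The positive integers n for which the graph G_{n,8} is considered. *)
definition admissible :: "nat \<Rightarrow> bool" where
  "admissible n \<longleftrightarrow> n > 0 \<and> 8 \<le> 1 / 648 * log 2 (log 2 (real n))"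

end

theory Submission
  imports Defs "HOL-Library.Transitive_Closure_Table"
begin

text \<open>Deleting half of the edges of an admissible graph leaves at least twice as many edges as
  vertices, hence a subgraph of minimum degree at least 3. In this subgraph the non-backtracking
  walks of length at most \<open>r\<close> from a fixed vertex have distinct endpoints as long as \<open>2 r\<close> is less
  than the girth, so some component has at least \<open>3 * 2 ^ r - 2\<close> vertices, which exceeds
  \<open>n powr (1/4608)\<close>. An induced subgraph that is too small for the separator hypothesis to apply
  has fewer vertices than the girth, so it is a forest, and removing the at most 48 edges at a
  centroid separates it.\<close>

section \<open>Simple graphs\<close>

lemma simple_graph_finite:
  assumes "simple_graph G"
  shows "finite (verts G)" "finite (edges G)"
proof -
  show 1: "finite (verts G)" using assms by (simp add: simple_graph_def)
  have "edges G \<subseteq> Pow (verts G)" using assms by (auto simp: simple_graph_def)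
  then show "finite (edges G)" using 1 by (meson finite_Pow_iff finite_subset)
qed

lemma simple_graph_edgeD:
  assumes "simple_graph G" "{x, y} \<in> edges G"
  shows "x \<in> verts G" "y \<in> verts G" "x \<noteq> y"
  using assms by (auto simp: simple_graph_def)

lemma induced_subgraph_refl: "simple_graph G \<Longrightarrow> induced_subgraph G G"
  by (auto simp: induced_subgraph_def simple_graph_def)

lemma induced_subgraph_trans:
  "induced_subgraph H K \<Longrightarrow> induced_subgraph K G \<Longrightarrow> induced_subgraph H G"
  by (auto simp: induced_subgraph_def)

lemma simple_graph_induced:
  assumes "simple_graph G" "induced_subgraph H G"
  shows "simple_graph H"
  using assms by (auto simp: simple_graph_def induced_subgraph_def intro: finite_subset)

lemma is_cycle_mono:
  assumes "is_cycle H vs" "verts H \<subseteq> verts G" "edges H \<subseteq> edges G"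
  shows "is_cycle G vs"
  using assms by (auto simp: is_cycle_def)

lemma is_cycle_length_ge:
  assumes "is_cycle G vs" "ereal x \<le> ereal_of_enat (girth G)"
  shows "x \<le> real (length vs)"
proof -
  have "girth G \<le> enat (length vs)"
    unfolding girth_def using assms(1) by (intro Inf_lower) auto
  then have "ereal_of_enat (girth G) \<le> ereal (real (length vs))"
    by (metis ereal_of_enat_le_iff ereal_of_enat_simps(1))
  with assms(2) have "ereal x \<le> ereal (real (length vs))" by (rule order_trans)
  then show ?thesis by simp
qed

section \<open>Degrees and edge density\<close>

lemma degree_mono:
  assumes "simple_graph G" "edges H \<subseteq> edges G"
  shows "degree H v \<le> degree G v"
  unfolding degree_def
  using assms simple_graph_finite[OF assms(1)] by (intro card_mono) auto

lemma degree_le_max_degree: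
  assumes "simple_graph G" "v \<in> verts G"
  shows "degree G v \<le> max_degree G"
  unfolding max_degree_def using assms simple_graph_finite by (intro Max_ge) auto

lemma degree_le_card_neighbours:
  assumes "simple_graph G"
  shows "degree G v \<le> card {u. {u, v} \<in> edges G}"
proof -
  have fin: "finite {u. {u, v} \<in> edges G}"
    by (rule finite_subset[OF _ simple_graph_finite(1)[OF assms]])
      (use simple_graph_edgeD[OF assms] in blast)
  have "{e \<in> edges G. v \<in> e} \<subseteq> (\<lambda>u. {u, v}) ` {u. {u, v} \<in> edges G}"
  proof
    fix e assume e: "e \<in> {e \<in> edges G. v \<in> e}"
    then have "card e = 2" using assms by (auto simp: simple_graph_def)
    then obtain a b where "e = {a, b}" by (auto simp: card_2_iff)
    then show "e \<in> (\<lambda>u. {u, v}) ` {u. {u, v} \<in> edges G}"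
      using e by (auto simp: insert_commute)
  qed
  then show ?thesis unfolding degree_def using fin by (meson surj_card_le)
qed

text \<open>Handshake identity: the incidences are counted once by vertices and once by
  edges.\<close>

lemma sum_degree:
  assumes "simple_graph G"
  shows "(\<Sum>v\<in>verts G. degree G v) = 2 * card (edges G)"
proof -
  note fin = simple_graph_finite[OF assms]
  have "(\<Sum>v\<in>verts G. degree G v) = (\<Sum>v\<in>verts G. \<Sum>e\<in>edges G. if v \<in> e then 1 else 0)"
    unfolding degree_def
    by (intro sum.cong refl) (simp add: fin sum.If_cases Int_def)
  also have "\<dots> = (\<Sum>e\<in>edges G. \<Sum>v\<in>verts G. if v \<in> e then 1 else 0)"
    by (rule sum.swap)
  also have "\<dots> = (\<Sum>e\<in>edges G. 2)"
  proof (intro sum.cong refl)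
    fix e assume "e \<in> edges G"
    then have "e \<subseteq> verts G" "card e = 2" using assms by (auto simp: simple_graph_def)
    then show "(\<Sum>v\<in>verts G. if v \<in> e then 1 else 0) = (2::nat)"
      by (simp add: fin sum.If_cases Int_absorb1)
  qed
  finally show ?thesis by simp
qed

text \<open>Deleting a vertex of degree at most \<open>d\<close> costs one vertex and at most
  \<open>d\<close> edges, so the density bound survives. Induction on the number of vertices
  therefore ends at a nonempty graph in which every degree exceeds \<open>d\<close>.\<close>

lemma exists_induced_min_degree:
  assumes "simple_graph G" "verts G \<noteq> {}" "d > 0" "d * card (verts G) \<le> card (edges G)"
  shows "\<exists>K. induced_subgraph K G \<and> verts K \<noteq> {} \<and> (\<forall>v\<in>verts K. d < degree K v)"
  using assms
proof (induction "card (verts G)" arbitrary: G rule: less_induct)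
  case less
  note fin = simple_graph_finite[OF \<open>simple_graph G\<close>]
  show ?case
  proof (cases "\<forall>v\<in>verts G. d < degree G v")
    case True
    then show ?thesis using less.prems induced_subgraph_refl by blast
  next
    case False
    then obtain v where v: "v \<in> verts G" "degree G v \<le> d" by force
    define K where "K = Graph (verts G - {v}) {e \<in> edges G. e \<subseteq> verts G - {v}}"
    have ind: "induced_subgraph K G" by (auto simp: K_def induced_subgraph_def)
    have cv: "card (verts G) = Suc (card (verts K))"
      using card_Suc_Diff1[OF fin(1) v(1)] by (simp add: K_def)
    have split: "edges G = edges K \<union> {e \<in> edges G. v \<in> e}"
      using less.prems(1) by (auto simp: K_def simple_graph_def)
    have ce: "card (edges G) \<le> card (edges K) + degree G v"
      unfolding degree_def by (subst split) (rule card_Un_le)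
    \<comment> \<open>A single vertex carries no edge, while the density bound with
      \<open>d > 0\<close> demands at least one.\<close>
    have "verts K \<noteq> {}"
    proof
      assume "verts K = {}"
      then have "verts G \<subseteq> {v}" by (auto simp: K_def)
      then have "card e \<le> card {v}" if "e \<in> edges G" for e
        using that less.prems(1) by (intro card_mono) (auto simp: simple_graph_def)
      then have "edges G = {}" using less.prems(1) by (force simp: simple_graph_def)
      then show False using less.prems(3,4) cv by simp
    qed
    moreover have "d * card (verts K) \<le> card (edges K)"
      using less.prems(4) ce cv v(2) by simp
    ultimately obtain J where "induced_subgraph J K" "verts J \<noteq> {}" "\<forall>v\<in>verts J. d < degree J v"
      using less.hyps[of K] cv simple_graph_induced[OF less.prems(1) ind] less.prems(3) by auto
    then show ?thesis using induced_subgraph_trans[OF _ ind] by blast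
  qed
qed

section \<open>Non-backtracking walks and the Moore bound\<close>

text \<open>A walk is its list of vertices, so it has one edge fewer than entries. The condition on
  \<open>hd zs\<close> forbids going straight back along the edge just used. The empty list is
  excluded so that \<open>hd\<close> and \<open>last\<close> are genuine endpoints.\<close>

fun nb_walk :: "'a graph \<Rightarrow> 'a list \<Rightarrow> bool" where
  "nb_walk G [] \<longleftrightarrow> False"
| "nb_walk G [x] \<longleftrightarrow> x \<in> verts G"
| "nb_walk G (x # y # zs) \<longleftrightarrow>
     {x, y} \<in> edges G \<and> (zs \<noteq> [] \<longrightarrow> hd zs \<noteq> x) \<and> nb_walk G (y # zs)"

lemma nb_walk_edge: "nb_walk G xs \<Longrightarrow> Suc i < length xs \<Longrightarrow> {xs ! i, xs ! Suc i} \<in> edges G"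
proof (induction G xs arbitrary: i rule: nb_walk.induct)
  case (3 G x y zs)
  then show ?case by (cases i) auto
qed auto

lemma nb_walk_verts: "simple_graph G \<Longrightarrow> nb_walk G xs \<Longrightarrow> set xs \<subseteq> verts G"
  by (induction G xs rule: nb_walk.induct) (auto dest: simple_graph_edgeD)

text \<open>Two walks that traverse the edge \<open>ab\<close> in opposite directions can be glued
  along it. The induction moves one vertex at a time from \<open>p\<close> to the front of the other
  walk.\<close>

lemma nb_walk_rev_append:
  "nb_walk G (a # b # p) \<Longrightarrow> nb_walk G (b # a # q) \<Longrightarrow> nb_walk G (rev p @ b # a # q)"
proof (induction p arbitrary: a b q)
  case (Cons c p)
  then have "nb_walk G (rev p @ c # b # a # q)"
    by (intro Cons.IH) (auto simp: insert_commute)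
  then show ?case by simp
qed auto

text \<open>If the head recurs in a repetition-free tail, the entries before its recurrence form a
  cycle. The walk lists that head twice, so it has more entries than the cycle, against the assumed
  bound.\<close>

lemma nb_walk_distinct:
  assumes "simple_graph G" "\<And>vs. is_cycle G vs \<Longrightarrow> length xs \<le> length vs" "nb_walk G xs"
  shows "distinct xs"
  using assms(2,3)
proof (induction xs)
  case (Cons x ys)
  show ?case
  proof (cases ys)
    case (Cons y zs)
    have walk: "nb_walk G (x # ys)" by fact
    have ys: "distinct ys"
      using Cons.IH Cons.prems Cons by (metis Suc_leD length_Cons nb_walk.simps(3))
    have "x \<notin> set ys"
    proof
      assume "x \<in> set ys"
      then obtain j where j: "j < length ys" "ys ! j = x" by (auto simp: in_set_conv_nth)
      \<comment> \<open>The recurrence cannot come at once, as there are no loops, nor one step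
        later, as the walk does not backtrack. This makes the cycle have length at least 3.\<close>
      have "x \<noteq> y" using walk Cons simple_graph_edgeD(3)[OF assms(1)] by auto
      then have "j \<noteq> 0" using j Cons by (metis nth_Cons_0)
      moreover have "j \<noteq> 1" using j walk Cons by (cases zs) auto
      ultimately have j2: "j \<ge> 2" by linarith
      define vs where "vs = take (Suc j) (x # ys)"
      have len: "length vs = Suc j" using j by (simp add: vs_def)
      have nth: "vs ! i = (x # ys) ! i" if "i \<le> j" for i
        using that by (simp add: vs_def del: take_Suc_Cons)
      have "x \<notin> set (take j ys)"
        using ys j by (auto simp: in_set_conv_nth nth_eq_iff_index_eq)
      then have "distinct vs" using ys by (simp add: vs_def)
      moreover have "set vs \<subseteq> verts G"
        using nb_walk_verts[OF assms(1) walk] set_take_subset[of "Suc j" "x # ys"]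
        unfolding vs_def by blast
      moreover have "{vs ! i, vs ! (Suc i mod length vs)} \<in> edges G" if "i < length vs" for i
      proof -
        have e: "{(x # ys) ! i, (x # ys) ! Suc i} \<in> edges G"
          using nb_walk_edge[OF walk, of i] that len j by simp
        show ?thesis
        proof (cases "i = j")
          case True
          then show ?thesis using e j len nth[of 0] nth[of j] by simp
        next
          case False
          then have "Suc i < Suc j" using that len by simp
          then show ?thesis using e len nth[of i] nth[of "Suc i"] by simp
        qed
      qed
      ultimately have "is_cycle G vs" using j2 len by (simp add: is_cycle_def)
      then have "length (x # ys) \<le> length vs" by (rule Cons.prems(1))
      then show False using len j by simp
    qed
    then show ?thesis using ys by simp
  qed simp
qed simp

text \<open>After the common initial vertices, the reverse of one walk glued to the other is again
  non-backtracking. It has at most \<open>2 * r + 1\<close> entries and repeats its endpoint,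
  contradicting \<open>nb_walk_distinct\<close>.\<close>

lemma nb_walk_unique:
  assumes "simple_graph G" "\<And>vs. is_cycle G vs \<Longrightarrow> 2 * r < length vs"
    and "nb_walk G p" "nb_walk G q" "hd p = hd q" "last p = last q"
    and "length p \<le> Suc r" "length q \<le> Suc r"
  shows "p = q"
  using assms(3-8)
proof (induction p arbitrary: q)
  case (Cons y p)
  then obtain q' where q: "q = y # q'" by (cases q) auto
  have dist: "distinct s" if "nb_walk G s" "length s \<le> Suc (2 * r)" for s
    by (rule nb_walk_distinct[OF assms(1) _ that(1)]) (use assms(2) that(2) in fastforce)
  have dp: "distinct (y # p)" and dq: "distinct (y # q')"
    using dist[of "y # p"] dist[of "y # q'"] Cons.prems q by auto
  show ?case
  \<comment> \<open>If one walk is the single vertex \<open>y\<close>, the other one ends where it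
    starts, and distinctness makes it trivial too.\<close>
  proof (cases "p = [] \<or> q' = []")
    case True
    then show ?thesis
      using Cons.prems(4) dp dq q
      by (auto split: if_splits)
  next
    case False
    then obtain b p' c q'' where p': "p = b # p'" and q'': "q' = c # q''"
      by (meson neq_Nil_conv)
    have wp: "nb_walk G p" and wq: "nb_walk G q'" using Cons.prems q p' q'' by auto
    show ?thesis
    proof (cases "b = c")
      case True
      then have "p = q'"
        using Cons.prems q p' q'' wp wq by (intro Cons.IH) auto
      then show ?thesis using q by simp
    next
      case False
      \<comment> \<open>Divergence right after \<open>y\<close> is exactly what keeps the turn at
        \<open>y\<close> from backtracking.\<close>
      then have "nb_walk G (b # y # c # q'')"
        using Cons.prems q p' q'' by (auto simp: insert_commute)
      then have "nb_walk G (rev p' @ b # y # c # q'')"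
        using Cons.prems(1) p' by (intro nb_walk_rev_append) auto
      then have "distinct (rev p' @ b # y # c # q'')"
        by (rule dist) (use Cons.prems(5,6) q p' q'' in simp)
      moreover have "last (b # p') = last (c # q'')" using Cons.prems(4) q p' q'' by simp
      then have "last (b # p') \<in> set (b # p') \<inter> set (c # q'')"
        by (metis IntI last_in_set list.distinct(1))
      ultimately show ?thesis by auto
    qed
  qed
qed simp

text \<open>The index \<open>k\<close> counts edges. The fixed vertex \<open>v\<close> stands last,
  so that \<open>#\<close> extends a walk at its free end \<open>hd p\<close>.\<close>

definition nb_walks :: "'a graph \<Rightarrow> 'a \<Rightarrow> nat \<Rightarrow> 'a list set" where
  "nb_walks G v k = {p. nb_walk G p \<and> last p = v \<and> length p = Suc k}"

lemma finite_nb_walks: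
  assumes "simple_graph G"
  shows "finite (nb_walks G v k)"
proof (rule finite_subset)
  show "nb_walks G v k \<subseteq> {p. set p \<subseteq> verts G \<and> length p = Suc k}"
    using nb_walk_verts[OF assms] by (auto simp: nb_walks_def)
  show "finite {p. set p \<subseteq> verts G \<and> length p = Suc k}"
    using simple_graph_finite[OF assms] by (intro finite_lists_length_eq)
qed

text \<open>Extensions of different walks differ, since the tail recovers the walk; hence the
  numbers of extensions add up. The guard \<open>tl p \<noteq> []\<close> covers the walk without
  edges, for which no neighbour is forbidden.\<close>

lemma card_nb_walks_Suc:
  assumes "simple_graph G"
    and "\<And>p. p \<in> nb_walks G v k \<Longrightarrow>
      c \<le> card {u. {u, hd p} \<in> edges G \<and> (tl p \<noteq> [] \<longrightarrow> hd (tl p) \<noteq> u)}"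
  shows "c * card (nb_walks G v k) \<le> card (nb_walks G v (Suc k))"
proof -
  define ext where "ext p = (\<lambda>u. u # p) `
    {u. {u, hd p} \<in> edges G \<and> (tl p \<noteq> [] \<longrightarrow> hd (tl p) \<noteq> u)}" for p
  have sub: "(\<Union>p\<in>nb_walks G v k. ext p) \<subseteq> nb_walks G v (Suc k)"
  proof
    fix x assume "x \<in> (\<Union>p\<in>nb_walks G v k. ext p)"
    then obtain p u where p: "p \<in> nb_walks G v k" "x = u # p" "{u, hd p} \<in> edges G"
      "tl p \<noteq> [] \<longrightarrow> hd (tl p) \<noteq> u" by (auto simp: ext_def)
    then show "x \<in> nb_walks G v (Suc k)" by (cases p) (auto simp: nb_walks_def)
  qed
  note fin = finite_nb_walks[OF assms(1)]
  have "c * card (nb_walks G v k) = (\<Sum>p\<in>nb_walks G v k. c)" by simp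
  also have "\<dots> \<le> (\<Sum>p\<in>nb_walks G v k. card (ext p))"
    by (intro sum_mono) (simp add: ext_def card_image inj_on_def assms(2))
  also have "\<dots> = card (\<Union>p\<in>nb_walks G v k. ext p)"
  proof (rule card_UN_disjoint[symmetric])
    show "\<forall>p\<in>nb_walks G v k. finite (ext p)"
      using sub fin by (meson UN_subset_iff finite_subset)
  qed (use fin in \<open>auto simp: ext_def\<close>)
  also have "\<dots> \<le> card (nb_walks G v (Suc k))" using sub fin by (intro card_mono)
  finally show ?thesis .
qed

text \<open>The first step from \<open>v\<close> has at least \<open>d + 1\<close> choices; each
  later one loses only the vertex just left and keeps at least \<open>d\<close>.\<close>

lemma card_nb_walks_ge:
  assumes "simple_graph G" "v \<in> verts G" "\<And>u. u \<in> verts G \<Longrightarrow> d < degree G u"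
  shows "(d + 1) * d ^ k \<le> card (nb_walks G v (Suc k))"
proof (induction k)
  have nbr: "d + 1 \<le> card {u. {u, x} \<in> edges G}" if "x \<in> verts G" for x
    using degree_le_card_neighbours[OF assms(1), of x] assms(3)[OF that] by simp
  case 0
  have "nb_walks G v 0 = {[v]}"
    using assms(2) by (auto simp: nb_walks_def length_Suc_conv)
  then show ?case
    using card_nb_walks_Suc[OF assms(1), of v 0 "d + 1"] nbr[OF assms(2)] by simp
next
  have nbr: "d + 1 \<le> card {u. {u, x} \<in> edges G}" if "x \<in> verts G" for x
    using degree_le_card_neighbours[OF assms(1), of x] assms(3)[OF that] by simp
  case (Suc k)
  have "d * card (nb_walks G v (Suc k)) \<le> card (nb_walks G v (Suc (Suc k)))"
  proof (rule card_nb_walks_Suc[OF assms(1)])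
    fix p assume p: "p \<in> nb_walks G v (Suc k)"
    then have "hd p \<in> verts G"
      using nb_walk_verts[OF assms(1), of p] by (cases p) (auto simp: nb_walks_def)
    then have "d + 1 \<le> card {u. {u, hd p} \<in> edges G}" by (rule nbr)
    then have "d \<le> card ({u. {u, hd p} \<in> edges G} - {hd (tl p)})"
      using diff_card_le_card_Diff[of "{hd (tl p)}" "{u. {u, hd p} \<in> edges G}"] by simp
    also have "\<dots> \<le> card {u. {u, hd p} \<in> edges G \<and> (tl p \<noteq> [] \<longrightarrow> hd (tl p) \<noteq> u)}"
    proof (rule card_mono)
      show "finite {u. {u, hd p} \<in> edges G \<and> (tl p \<noteq> [] \<longrightarrow> hd (tl p) \<noteq> u)}"
        by (rule finite_subset[OF _ simple_graph_finite(1)[OF assms(1)]])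
          (use simple_graph_edgeD[OF assms(1)] in blast)
    qed auto
    finally show "d \<le> card {u. {u, hd p} \<in> edges G \<and> (tl p \<noteq> [] \<longrightarrow> hd (tl p) \<noteq> u)}" .
  qed
  moreover have "d * ((d + 1) * d ^ k) \<le> d * card (nb_walks G v (Suc k))"
    using Suc.IH by (rule mult_le_mono2)
  ultimately show ?case by (simp add: algebra_simps)
qed

lemma nb_walk_hd_in_component:
  assumes "simple_graph G" "nb_walk G p"
  shows "hd p \<in> component_of G (last p)"
proof -
  have "nb_walk G p \<Longrightarrow> (last p, hd p) \<in> {(x, y). {x, y} \<in> edges G}\<^sup>*"
  proof (induction G p rule: nb_walk.induct)
    case (3 G x y zs)
    then have "(last (y # zs), y) \<in> {(x, y). {x, y} \<in> edges G}\<^sup>*" "{y, x} \<in> edges G"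
      by (auto simp: insert_commute)
    then show ?case by (auto intro: rtrancl_into_rtrancl)
  qed auto
  moreover have "hd p \<in> verts G"
    using nb_walk_verts[OF assms] assms(2) by (cases p) auto
  ultimately show ?thesis using assms(2) by (simp add: component_of_def)
qed

text \<open>Walks with at most \<open>r\<close> edges are determined by their free endpoint through
  \<open>nb_walk_unique\<close>, and all these endpoints lie in the component of \<open>v\<close>.
  Counting the walks by length thus bounds the component from below.\<close>

lemma moore_bound:
  assumes "simple_graph G" "v \<in> verts G" "\<And>u. u \<in> verts G \<Longrightarrow> d < degree G u"
    and "\<And>vs. is_cycle G vs \<Longrightarrow> 2 * r < length vs"
  shows "1 + (\<Sum>k<r. (d + 1) * d ^ k) \<le> card (component_of G v)"
proof -
  note fin = finite_nb_walks[OF assms(1)]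
  define W where "W = (\<Union>k\<in>{..r}. nb_walks G v k)"
  have "1 + (\<Sum>k<r. (d + 1) * d ^ k) \<le> card (nb_walks G v 0) + (\<Sum>k<r. card (nb_walks G v (Suc k)))"
  proof (intro add_mono sum_mono card_nb_walks_ge assms)
    have "nb_walks G v 0 = {[v]}"
      using assms(2) by (auto simp: nb_walks_def length_Suc_conv)
    then show "1 \<le> card (nb_walks G v 0)" by simp
  qed
  also have "\<dots> = (\<Sum>k\<le>r. card (nb_walks G v k))"
    unfolding lessThan_Suc_atMost[symmetric] sum.lessThan_Suc_shift ..
  also have "\<dots> = card W"
    unfolding W_def
    by (rule card_UN_disjoint[symmetric]) (use fin in \<open>auto simp: nb_walks_def\<close>)
  also have "\<dots> \<le> card (component_of G v)"
  proof (rule card_inj_on_le)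
    show "inj_on hd W"
    proof (rule inj_onI)
      fix p q assume "p \<in> W" "q \<in> W" "hd p = hd q"
      then show "p = q"
        by (intro nb_walk_unique[of G r]) (use assms(1,4) in \<open>auto simp: W_def nb_walks_def\<close>)
    qed
    show "hd ` W \<subseteq> component_of G v"
      using nb_walk_hd_in_component[OF assms(1)] by (auto simp: W_def nb_walks_def)
    show "finite (component_of G v)"
      using simple_graph_finite[OF assms(1)] by (simp add: component_of_def)
  qed
  finally show ?thesis .
qed

section \<open>Edge separators of forests\<close>

text \<open>A simple path from \<open>x\<close> to \<open>y\<close> avoiding \<open>v\<close> closes
  up through \<open>v\<close> to a cycle. So in a forest \<open>v\<close> has at most one neighbour
  in each component left after removing \<open>v\<close>.\<close>

lemma acyclic_unique_neighbour:
  assumes "simple_graph G" "\<nexists>vs. is_cycle G vs"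
    and "(x, y) \<in> {(a, b). {a, b} \<in> edges G \<and> a \<noteq> v \<and> b \<noteq> v}\<^sup>*"
    and "{v, x} \<in> edges G" "{v, y} \<in> edges G"
  shows "x = y"
proof (rule ccontr)
  assume ne: "x \<noteq> y"
  define R where "R = (\<lambda>a b. {a, b} \<in> edges G \<and> a \<noteq> v \<and> b \<noteq> v)"
  have "R\<^sup>*\<^sup>* x y"
    using assms(3) by (simp add: rtrancl_def R_def)
  then obtain xs where path: "rtrancl_path R x xs y" and dist: "distinct (x # xs)"
    by (meson rtranclp_eq_rtrancl_path rtrancl_path_distinct)
  have nth: "R ((x # xs) ! i) (xs ! i)" if "i < length xs" for i
    using rtrancl_path_nth[OF path that] .
  have xs: "xs \<noteq> []" using path ne by (auto elim: rtrancl_path.cases)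
  have last: "last xs = y" using rtrancl_path_last[OF path xs] .
  have mem: "w \<in> verts G \<and> w \<noteq> v" if "w \<in> set xs" for w
    using nth that by (auto simp: in_set_conv_nth R_def dest: simple_graph_edgeD[OF assms(1)])
  have x: "x \<in> verts G" "v \<in> verts G" "v \<noteq> x"
    using simple_graph_edgeD[OF assms(1,4)] by auto
  define vs where "vs = v # x # xs"
  have "is_cycle G vs"
    unfolding is_cycle_def
  proof (intro conjI allI impI)
    show "3 \<le> length vs" using xs by (cases xs) (auto simp: vs_def)
    show "distinct vs" using dist mem x by (auto simp: vs_def)
    show "set vs \<subseteq> verts G" using mem x by (auto simp: vs_def)
    fix i assume i: "i < length vs"
    consider "i = 0" | j where "i = Suc j" "j < length xs" | "i = Suc (length xs)"
      using i by (cases i) (auto simp: vs_def less_Suc_eq)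
    then show "{vs ! i, vs ! (Suc i mod length vs)} \<in> edges G"
    proof cases
      case 1
      then show ?thesis using assms(4) by (simp add: vs_def)
    next
      case 2
      then show ?thesis using nth[of j] by (simp add: vs_def R_def)
    next
      case 3
      then have "vs ! i = y" using last xs by (simp add: vs_def last_conv_nth nth_Cons')
      moreover have "vs ! (Suc i mod length vs) = v" using 3 by (simp add: vs_def)
      ultimately show ?thesis using assms(5) by (simp add: insert_commute)
    qed
  qed
  then show False using assms(2) by blast
qed

text \<open>Apart from \<open>v\<close> itself, which may lie inside or outside, such a set is a
  union of components of the graph without \<open>v\<close>. Its boundary edges all contain
  \<open>v\<close>, hence disappear when the edges at \<open>v\<close> are cut.\<close>

definition separated :: "'a graph \<Rightarrow> 'a \<Rightarrow> 'a set \<Rightarrow> bool" where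
  "separated G v P \<longleftrightarrow> P \<subseteq> verts G \<and>
     (\<forall>a\<in>P. \<forall>b\<in>verts G - P. {a, b} \<in> edges G \<longrightarrow> a = v \<or> b = v)"

lemma separated_Int: "separated G v P \<Longrightarrow> separated G v Q \<Longrightarrow> separated G v (P \<inter> Q)"
  unfolding separated_def by blast

lemma separated_Diff:
  assumes "separated G v P" "separated G v Q"
  shows "separated G v (P - Q)"
  unfolding separated_def
proof (intro conjI ballI impI)
  show "P - Q \<subseteq> verts G" using assms by (auto simp: separated_def)
  fix a b assume *: "a \<in> P - Q" "b \<in> verts G - (P - Q)" "{a, b} \<in> edges G"
  then have "{b, a} \<in> edges G" by (simp add: insert_commute)
  then show "a = v \<or> b = v" using * assms unfolding separated_def by blast
qed

text \<open>The centroid is the vertex through which a smallest set with more than half of the vertices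
  is attached to its complement.\<close>
lemma forest_centroid:
  assumes "simple_graph G" "\<nexists>vs. is_cycle G vs" "2 \<le> card (verts G)"
  obtains v where "v \<in> verts G"
    "\<And>x. x \<in> verts G \<Longrightarrow> \<exists>P. separated G v P \<and> x \<in> P \<and> 2 * card P \<le> card (verts G)"
proof -
  note fin = simple_graph_finite[OF assms(1)]
  define heavy where "heavy S x \<longleftrightarrow> S \<subseteq> verts G \<and> x \<in> S \<and> card (verts G) < 2 * card S \<and>
    (\<forall>a\<in>S. \<forall>b\<in>verts G - S. {a, b} \<in> edges G \<longrightarrow> a = x)" for S x
  obtain x0 where "x0 \<in> verts G" using assms(3) by fastforce
  then have "heavy (verts G) x0" using assms(3) by (auto simp: heavy_def)
  then obtain S where "\<exists>x. heavy S x" and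
    min: "\<And>T. \<exists>x. heavy T x \<Longrightarrow> card S \<le> card T"
    using ex_has_least_nat[of "\<lambda>S. \<exists>x. heavy S x" "verts G" card] by blast
  then obtain v where v: "heavy S v" by blast
  show ?thesis
  proof
    show "v \<in> verts G" using v by (auto simp: heavy_def)
    fix x assume x: "x \<in> verts G"
    show "\<exists>P. separated G v P \<and> x \<in> P \<and> 2 * card P \<le> card (verts G)"
    proof (cases "x \<in> S")
      case False
      \<comment> \<open>Outside \<open>S\<close> the complement of \<open>S\<close> serves: it has
        less than half of the vertices and is attached only through \<open>v\<close>.\<close>
      have "card (verts G - S) = card (verts G) - card S"
        using v fin by (intro card_Diff_subset) (auto simp: heavy_def intro: finite_subset)
      then have "2 * card (verts G - S) \<le> card (verts G)" using v by (auto simp: heavy_def)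
      moreover have "separated G v (verts G - S)"
        unfolding separated_def
      proof (intro conjI ballI impI)
        fix a b assume *: "a \<in> verts G - S" "b \<in> verts G - (verts G - S)" "{a, b} \<in> edges G"
        then have "{b, a} \<in> edges G" by (simp add: insert_commute)
        then show "a = v \<or> b = v" using * v by (auto simp: heavy_def)
      qed auto
      ultimately show ?thesis using x False by blast
    next
      case True
      show ?thesis
      proof (cases "x = v")
        case True
        then have "separated G v {v}" using x by (auto simp: separated_def)
        then show ?thesis using True assms(3) by (intro exI[of _ "{v}"]) auto
      next
        case False
        \<comment> \<open>\<open>C\<close> will be the component of \<open>x\<close> in the graph
          induced on \<open>S - {v}\<close>. Edges leaving it can only reach \<open>v\<close>,
          because \<open>S\<close> itself is left only from \<open>v\<close>.\<close>
        define R where "R = {(a, b). {a, b} \<in> edges G \<and> a \<in> S - {v} \<and> b \<in> S - {v}}"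
        define C where "C = {y. (x, y) \<in> R\<^sup>*}"
        have CS: "C \<subseteq> S - {v}"
        proof
          fix y assume "y \<in> C"
          then have "(x, y) \<in> R\<^sup>*" by (simp add: C_def)
          then show "y \<in> S - {v}"
            by (cases rule: rtranclE) (use True False in \<open>auto simp: R_def\<close>)
        qed
        have xC: "x \<in> C" by (simp add: C_def)
        have bd: "b = v" if "a \<in> C" "b \<in> verts G - C" "{a, b} \<in> edges G" for a b
        proof (rule ccontr)
          assume "b \<noteq> v"
          show False
          proof (cases "b \<in> S")
            case True
            then have "(a, b) \<in> R" using that CS \<open>b \<noteq> v\<close> by (auto simp: R_def)
            then have "b \<in> C" using that(1) by (auto simp: C_def intro: rtrancl_into_rtrancl)
            then show False using that by simp
          next
            case False
            then show False using that CS v by (auto simp: heavy_def)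
          qed
        qed
        have symR: "sym (R\<^sup>*)"
          by (intro sym_rtrancl) (auto simp: R_def sym_def insert_commute)
        have uniq: "a = a'" if "a \<in> C" "a' \<in> C" "{v, a} \<in> edges G" "{v, a'} \<in> edges G" for a a'
        proof (rule acyclic_unique_neighbour[OF assms(1,2) _ that(3,4)])
          have "(a, x) \<in> R\<^sup>*" "(x, a') \<in> R\<^sup>*" using that symR by (auto simp: C_def sym_def)
          then have "(a, a') \<in> R\<^sup>*" by (rule rtrancl_trans)
          moreover have "R \<subseteq> {(a, b). {a, b} \<in> edges G \<and> a \<noteq> v \<and> b \<noteq> v}"
            by (auto simp: R_def)
          ultimately show "(a, a') \<in> {(a, b). {a, b} \<in> edges G \<and> a \<noteq> v \<and> b \<noteq> v}\<^sup>*"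
            using rtrancl_mono by blast
        qed
        \<comment> \<open>Acyclicity yields one attachment vertex \<open>z\<close> of
          \<open>C\<close> (any vertex of \<open>C\<close> if \<open>v\<close> has no neighbour
          there). With more than half of the vertices \<open>C\<close> would be heavy, yet it is
          smaller than \<open>S\<close> since it misses \<open>v\<close>.\<close>
        have "\<exists>z\<in>C. \<forall>a\<in>C. {v, a} \<in> edges G \<longrightarrow> a = z" using uniq xC by metis
        then obtain z where z: "z \<in> C" "\<forall>a\<in>C. {v, a} \<in> edges G \<longrightarrow> a = z" by blast
        have CV: "C \<subseteq> verts G" using CS v by (auto simp: heavy_def)
        have "2 * card C \<le> card (verts G)"
        proof (rule ccontr)
          assume "\<not> ?thesis"
          then have "heavy C z"
            using z bd CV by (force simp: heavy_def insert_commute)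
          then have "card S \<le> card C" using min by blast
          moreover have "card C < card S"
            using CS v fin by (intro psubset_card_mono) (auto simp: heavy_def intro: finite_subset)
          ultimately show False by simp
        qed
        moreover have "separated G v C" using bd CV by (auto simp: separated_def)
        ultimately show ?thesis using xC by blast
      qed
    qed
  qed
qed

text \<open>With \<open>v\<close> the centroid, a smallest separated set \<open>A\<close> holding at
  least a third of the vertices also holds at most two thirds. Otherwise a piece \<open>P\<close> of
  at most half size would cut \<open>A\<close> into two parts, one of them still holding a
  third.\<close>

lemma forest_edge_separator:
  assumes "simple_graph G" "\<nexists>vs. is_cycle G vs" "2 \<le> card (verts G)"
  obtains v where "v \<in> verts G" "edge_separator G {e \<in> edges G. v \<in> e}"
proof -
  note fin = simple_graph_finite[OF assms(1)]
  obtain v where v: "v \<in> verts G"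
    "\<And>x. x \<in> verts G \<Longrightarrow> \<exists>P. separated G v P \<and> x \<in> P \<and> 2 * card P \<le> card (verts G)"
    by (rule forest_centroid[OF assms]) blast
  let ?Q = "\<lambda>A. separated G v A \<and> card (verts G) \<le> 3 * card A"
  have "?Q (verts G)" by (simp add: separated_def)
  then obtain A where A: "?Q A" and min: "\<And>T. ?Q T \<Longrightarrow> card A \<le> card T"
    using ex_has_least_nat[of ?Q "verts G" card] by blast
  have AV: "A \<subseteq> verts G" using A by (simp add: separated_def)
  have finA: "finite A" using AV fin finite_subset by blast
  have small: "3 * card A \<le> 2 * card (verts G)"
  proof (rule ccontr)
    assume big: "\<not> ?thesis"
    then obtain x where x: "x \<in> A" by fastforce
    then obtain P where P: "separated G v P" "x \<in> P" "2 * card P \<le> card (verts G)"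
      using v(2) AV by blast
    have finP: "finite P" using P fin finite_subset by (auto simp: separated_def)
    have split: "card A = card (A - P) + card (A \<inter> P)"
      using finA by (metis card_Diff_subset_Int card_mono finite_Int inf_le1 le_add_diff_inverse2)
    \<comment> \<open>As \<open>P\<close> meets \<open>A\<close>, the part \<open>A - P\<close> is
      strictly smaller than \<open>A\<close> and by minimality holds less than a third. So
      \<open>A \<inter> P\<close> holds a third, and minimality forces \<open>A\<close> inside the
      size of \<open>P\<close>.\<close>
    have "card (A \<inter> P) > 0" using x P finA by (auto simp: card_gt_0_iff)
    then have "\<not> card (verts G) \<le> 3 * card (A - P)"
      using min[of "A - P"] separated_Diff[of G v A P] A P(1) split by linarith
    then have "card (verts G) \<le> 3 * card (A \<inter> P)" using big split by linarith
    then have "card A \<le> card (A \<inter> P)"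
      using A P(1) by (intro min conjI separated_Int) auto
    also have "\<dots> \<le> card P" using finP by (intro card_mono) auto
    finally show False using big P(3) assms(3) by linarith
  qed
  have "edge_separator G {e \<in> edges G. v \<in> e}"
    unfolding edge_separator_def
  proof (intro conjI exI)
    show "A \<union> (verts G - A) = verts G" using AV by blast
    show "real (card A) \<le> 2/3 * real (card (verts G))" using small by linarith
    have "card (verts G - A) = card (verts G) - card A"
      using AV finA by (rule card_Diff_subset[rotated])
    then show "real (card (verts G - A)) \<le> 2/3 * real (card (verts G))"
      using A by linarith
    show "\<forall>a\<in>A. \<forall>b\<in>verts G - A. {a, b} \<notin> edges G - {e \<in> edges G. v \<in> e}"
      using A unfolding separated_def by blast
  qed auto
  then show ?thesis using v(1) that by blast
qed

lemma forest_sep_E: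
  assumes "simple_graph G" "\<nexists>vs. is_cycle G vs" "2 \<le> card (verts G)"
    and "\<And>v. v \<in> verts G \<Longrightarrow> degree G v \<le> d"
  shows "sep_E G \<le> enat d"
proof -
  obtain v where v: "v \<in> verts G" "edge_separator G {e \<in> edges G. v \<in> e}"
    using forest_edge_separator[OF assms(1-3)] .
  then have "sep_E G \<le> enat (degree G v)"
    unfolding sep_E_def degree_def by (intro Inf_lower) auto
  also have "\<dots> \<le> enat d" using assms(4)[OF v(1)] by simp
  finally show ?thesis .
qed

section \<open>Failure of hyperfiniteness\<close>

lemma component_of_mono:
  assumes "verts K \<subseteq> verts G" "edges K \<subseteq> edges G"
  shows "component_of K v \<subseteq> component_of G v"
proof -
  have "{(x, y). {x, y} \<in> edges K}\<^sup>* \<subseteq> {(x, y). {x, y} \<in> edges G}\<^sup>*"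
    using assms(2) by (intro rtrancl_mono) auto
  then show ?thesis using assms(1) by (auto simp: component_of_def)
qed

lemma hyperfinite_mono:
  assumes "hyperfinite \<epsilon> q G" "q \<le> q'"
  shows "hyperfinite \<epsilon> q' G"
  using assms unfolding hyperfinite_def by (meson order_trans)

text \<open>Closed form of the Moore bound for minimum degree 3.\<close>

lemma geometric_sum_3: "1 + (\<Sum>k<r. 3 * 2 ^ k) = 3 * 2 ^ r - (2::real)"
  by (induction r) auto

text \<open>Average degree 8 gives four edges per vertex, and two remain after the deletion. That
  suffices for a subgraph of minimum degree 3, to which the Moore bound applies with the girth of
  \<open>G\<close>.\<close>

lemma not_hyperfinite_of_girth:
  assumes "simple_graph G" "verts G \<noteq> {}" "8 \<le> average_degree G"
    and "ereal g \<le> ereal_of_enat (girth G)" "4 < g"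
  shows "\<not> hyperfinite (1/2) (2 powr (g / 2)) G"
proof
  assume "hyperfinite (1/2) (2 powr (g / 2)) G"
  then obtain F where F: "F \<subseteq> edges G" "real (card F) \<le> 1/2 * real (card (edges G))"
    "\<And>C. C \<in> components (delete_edges G F) \<Longrightarrow> real (card C) \<le> 2 powr (g / 2)"
    unfolding hyperfinite_def by blast
  note fin = simple_graph_finite[OF assms(1)]
  define D where "D = delete_edges G F"
  have sD: "simple_graph D" using assms(1) by (auto simp: D_def delete_edges_def simple_graph_def)
  have vD: "verts D = verts G" "edges D = edges G - F" by (auto simp: D_def delete_edges_def)
  have "(\<Sum>v\<in>verts G. real (degree G v)) = real (2 * card (edges G))"
    by (metis of_nat_sum sum_degree[OF assms(1)])
  moreover have "card (verts G) > 0" using assms(2) fin by (simp add: card_gt_0_iff)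
  ultimately have "8 * real (card (verts G)) \<le> real (2 * card (edges G))"
    using assms(3) by (simp add: average_degree_def field_simps)
  moreover have "card (edges D) = card (edges G) - card F"
    using F(1) fin vD finite_subset by (metis card_Diff_subset)
  ultimately have "2 * card (verts D) \<le> card (edges D)"
    using F(2) unfolding vD(1) by linarith
  then obtain K where K: "induced_subgraph K D" "verts K \<noteq> {}" "\<forall>v\<in>verts K. 2 < degree K v"
    using exists_induced_min_degree[OF sD, of 2] assms(2) vD by auto
  then obtain v where v: "v \<in> verts K" by blast
  have sub: "verts K \<subseteq> verts D" "edges K \<subseteq> edges D" using K(1) by (auto simp: induced_subgraph_def)
  \<comment> \<open>The largest radius with \<open>2 * r < g\<close>; rounding costs at most a
    factor 2 in \<open>2 ^ r\<close>.\<close>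
  define r where "r = nat \<lceil>g / 2\<rceil> - 1"
  have r: "2 * real r < g" "g / 2 - 1 \<le> real r" using assms(5) unfolding r_def by linarith+
  have girth: "2 * r < length vs" if "is_cycle K vs" for vs
  proof -
    have "is_cycle G vs" using that sub vD by (intro is_cycle_mono[OF that]) auto
    then have "g \<le> real (length vs)" using is_cycle_length_ge assms(4) by blast
    then show ?thesis using r(1) by linarith
  qed
  have "1 + (\<Sum>k<r. (2 + 1) * 2 ^ k) \<le> card (component_of K v)"
    using moore_bound[OF simple_graph_induced[OF sD K(1)] v, of 2 r] K(3) girth by blast
  also have "\<dots> \<le> card (component_of D v)"
    using component_of_mono[OF sub] simple_graph_finite[OF sD]
    by (intro card_mono) (auto simp: component_of_def)
  finally have "real (1 + (\<Sum>k<r. (2 + 1) * 2 ^ k)) \<le> real (card (component_of D v))"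
    by (rule of_nat_mono)
  then have "1 + (\<Sum>k<r. 3 * 2 ^ k) \<le> real (card (component_of D v))" by simp
  then have "3 * 2 ^ r - 2 \<le> real (card (component_of D v))"
    unfolding geometric_sum_3 .
  also have "\<dots> \<le> 2 powr (g / 2)"
    using F(3) v sub by (auto simp: components_def D_def)
  finally have le: "3 * 2 ^ r - 2 \<le> 2 powr (g / 2)" .
  have "2 powr (g / 2) / 2 = 2 powr (g / 2 - 1)" by (simp add: powr_diff)
  also have "\<dots> \<le> 2 powr real r" using r(2) by simp
  also have "\<dots> = 2 ^ r" by (simp add: powr_realpow)
  finally have "2 powr (g / 2) / 2 \<le> 2 ^ r" .
  \<comment> \<open>With \<open>x = 2 powr (g / 2)\<close> the component has at least
    \<open>3 * x / 2 - 2\<close> vertices, which exceeds \<open>x\<close> exactly when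
    \<open>x > 4\<close>; this is where \<open>4 < g\<close> enters.\<close>
  moreover have "2 powr (g / 2) > 2 powr (2::real)" using assms(5) by (intro powr_less_mono) auto
  ultimately show False using le by simp
qed

section \<open>Growth of the iterated logarithm\<close>

lemma admissible_log_ge:
  assumes "admissible n"
  shows "2 powr 5184 \<le> log 2 (real n)"
proof -
  have n: "n > 0" "5184 \<le> log 2 (log 2 (real n))" using assms by (auto simp: admissible_def)
  have "0 \<le> log 2 (real n)" using n(1) by simp
  \<comment> \<open>The case \<open>n = 1\<close> is excluded by the convention
    \<open>log 2 0 = 0\<close>, which is below 5184 = 8 * 648.\<close>
  moreover have "log 2 (real n) \<noteq> 0" using n(2) by (auto simp: log_def)
  ultimately have "0 < log 2 (real n)" by simp
  then show ?thesis using n(2) by (subst (asm) le_log_iff) auto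
qed

text \<open>Supplies arbitrarily large admissible sizes, so that no single component bound can serve
  the whole family.\<close>

lemma log_log_unbounded: "\<exists>n\<ge>N. n > 0 \<and> c \<le> log 2 (log 2 (real n))"
proof -
  obtain M :: nat where M: "2 powr (2 powr c) \<le> real M" using real_arch_simple by blast
  define n where "n = max M (max N 1)"
  have n: "2 powr (2 powr c) \<le> real n" "n > 0" using M by (auto simp: n_def)
  then have "2 powr c \<le> log 2 (real n)" by (subst le_log_iff) auto
  moreover from this have "0 < log 2 (real n)"
    by (rule less_le_trans[rotated]) simp
  ultimately have "c \<le> log 2 (log 2 (real n))" by (subst le_log_iff) auto
  then show ?thesis using n(2) by (intro exI[of _ n]) (simp add: n_def)
qed

lemma admissible_ge_ex: "\<exists>n\<ge>N. admissible n"
  using log_log_unbounded[of N 5184] by (auto simp: admissible_def)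

theorem corollary2p7:
  fixes G :: "nat \<Rightarrow> 'a graph"
  assumes "\<And>n. admissible n \<Longrightarrow> simple_graph (G n) \<and> card (verts (G n)) = n"
    and "\<And>n. admissible n \<Longrightarrow> average_degree (G n) \<ge> 8 \<and> max_degree (G n) \<le> 48"
    and "\<And>n. admissible n \<Longrightarrow>
           ereal_of_enat (girth (G n)) \<ge> ereal (log 2 (real n) / 48 ^ 2)"
    and "\<And>n H t. admissible n \<Longrightarrow> subgraph H (G n) \<Longrightarrow> t = real (card (verts H)) \<Longrightarrow>
           t \<ge> log 2 (real n) / 48 ^ 2 \<Longrightarrow>
           sep_V H \<le> sep_E H \<and>
           ereal_of_enat (sep_E H) \<le> ereal (t / log 2 t * (log 2 (log 2 t)) ^ 2)"
  shows "(\<forall>n. admissible n \<longrightarrow> \<not> hyperfinite (1/2) (real n powr (1/4608)) (G n)) \<and>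
         (let \<F> = {H. \<exists>n. admissible n \<and> induced_subgraph H (G n)} in
            (\<forall>H\<in>\<F>. simple_graph H) \<and> hereditary \<F> \<and> \<not> hyperfinite_family \<F> \<and>
            (\<forall>H\<in>\<F>. \<forall>m. m = card (verts H) \<longrightarrow> m \<ge> 2 \<longrightarrow>
               ereal_of_enat (sep_E H) \<le>
                 ereal (real m / log 2 (real m) * (log 2 (log 2 (real m))) ^ 2 + 48)))"
proof -
  define \<F> where "\<F> = {H. \<exists>n. admissible n \<and> induced_subgraph H (G n)}"
  have not_hyp: "\<not> hyperfinite (1/2) (real n powr (1/4608)) (G n)" if n: "admissible n" for n
  proof -
    have pos: "n > 0" using n by (simp add: admissible_def)
    \<comment> \<open>The exponent 14 suffices because 4 * 48^2 = 9216 < 2^14.\<close>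
    have "(2::real) powr 14 \<le> 2 powr 5184" by (rule powr_mono) auto
    then have "2 powr 14 \<le> log 2 (real n)" using admissible_log_ge[OF n] by (rule order_trans)
    then have "4 * 48 ^ 2 < log 2 (real n)" by simp
    then have "4 < log 2 (real n) / 48 ^ 2" by simp
    moreover have "verts (G n) \<noteq> {}" using assms(1)[OF n] pos by auto
    ultimately have "\<not> hyperfinite (1/2) (2 powr (log 2 (real n) / 48 ^ 2 / 2)) (G n)"
      using assms(1,2,3)[OF n] by (intro not_hyperfinite_of_girth) auto
    \<comment> \<open>Here 4608 = 2 * 48^2: half of the girth bound in the exponent.\<close>
    moreover have "2 powr (log 2 (real n) / 48 ^ 2 / 2) = real n powr (1/4608)"
    proof -
      have "real n powr (1/4608) = (2 powr log 2 (real n)) powr (1/4608)" using pos by simp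
      also have "\<dots> = 2 powr (log 2 (real n) / 48 ^ 2 / 2)" unfolding powr_powr by simp
      finally show ?thesis by simp
    qed
    ultimately show ?thesis by simp
  qed
  have simple: "simple_graph H" if "H \<in> \<F>" for H
    using that assms(1) simple_graph_induced by (auto simp: \<F>_def)
  have hered: "hereditary \<F>"
    unfolding hereditary_def \<F>_def using induced_subgraph_trans by blast
  have not_fam: "\<not> hyperfinite_family \<F>"
  proof
    assume "hyperfinite_family \<F>"
    then obtain q where q: "\<And>H. H \<in> \<F> \<Longrightarrow> hyperfinite (1/2) q H"
      unfolding hyperfinite_family_def by (metis half_gt_zero zero_less_one)
    \<comment> \<open>Here \<open>q\<close> is the bound for 1/2. From size \<open>N\<close> on,
      \<open>n powr (1/4608)\<close> is at least \<open>q\<close>; the maximum with 1 keeps the base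
      positive.\<close>
    obtain N :: nat where N: "max q 1 powr 4608 \<le> real N" using real_arch_simple by blast
    obtain n where n: "n \<ge> N" "admissible n" using admissible_ge_ex by blast
    have "q \<le> (max q 1 powr 4608) powr (1/4608)" unfolding powr_powr by simp
    also have "\<dots> \<le> real n powr (1/4608)" using N n by (intro powr_mono2) auto
    finally have "q \<le> real n powr (1/4608)" .
    moreover have "G n \<in> \<F>"
      using n assms(1) induced_subgraph_refl by (auto simp: \<F>_def)
    ultimately show False using not_hyp n(2) hyperfinite_mono q by blast
  qed
  have sep: "ereal_of_enat (sep_E H) \<le>
      ereal (real m / log 2 (real m) * (log 2 (log 2 (real m))) ^ 2 + 48)"
    if H: "H \<in> \<F>" and m: "m = card (verts H)" "m \<ge> 2" for H m
  proof -
    obtain n where n: "admissible n" "induced_subgraph H (G n)" using H by (auto simp: \<F>_def)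
    have sub: "verts H \<subseteq> verts (G n)" "edges H \<subseteq> edges (G n)"
      using n(2) by (auto simp: induced_subgraph_def)
    show ?thesis
    proof (cases "log 2 (real n) / 48 ^ 2 \<le> real m")
      case True
      have "ereal_of_enat (sep_E H) \<le> ereal (real m / log 2 (real m) * (log 2 (log 2 (real m))) ^ 2)"
        using assms(4)[OF n(1) _ _ True, of H] simple[OF H] sub m(1) by (simp add: subgraph_def)
      also have "\<dots> \<le> ereal (real m / log 2 (real m) * (log 2 (log 2 (real m))) ^ 2 + 48)"
        by simp
      finally show ?thesis .
    next
      case False
      \<comment> \<open>A cycle of \<open>H\<close> would be a cycle of \<open>G n\<close> with at
        most \<open>m\<close> vertices, fewer than the girth allows.\<close>
      have "\<nexists>vs. is_cycle H vs"
      proof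
        assume "\<exists>vs. is_cycle H vs"
        then obtain vs where vs: "is_cycle H vs" by blast
        then have "log 2 (real n) / 48 ^ 2 \<le> real (length vs)"
          using is_cycle_length_ge[OF is_cycle_mono[OF vs sub]] assms(3)[OF n(1)] by blast
        moreover have "length vs \<le> m"
          using vs simple_graph_finite[OF simple[OF H]] unfolding m(1) is_cycle_def
          by (metis card_mono distinct_card)
        ultimately show False using False by linarith
      qed
      moreover have "degree H v \<le> 48" if "v \<in> verts H" for v
        using degree_mono[OF _ sub(2), of v] degree_le_max_degree[of "G n" v] that sub(1)
          assms(1,2)[OF n(1)] by force
      ultimately have "sep_E H \<le> enat 48"
        using simple[OF H] m by (intro forest_sep_E) auto
      then have "ereal_of_enat (sep_E H) \<le> ereal_of_enat (enat 48)"
        by (simp only: ereal_of_enat_le_iff)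
      \<comment> \<open>For \<open>m \<ge> 2\<close> the main term is nonnegative, so the additive
        48 alone pays for the edges at the centroid.\<close>
      also have "\<dots> \<le> ereal (real m / log 2 (real m) * (log 2 (log 2 (real m))) ^ 2 + 48)"
        using m(2) by simp
      finally show ?thesis .
    qed
  qed
  show ?thesis
    unfolding Let_def \<F>_def[symmetric] using not_hyp simple hered not_fam sep by blast
qed

end
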